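(* Let $g\in\mathbb C[t]$ be a polynomial with zero constant term. The $\mathfrak{sl}(2)$-module $T_3(g)$ is simple if and only if $g$ is not an even polynomial, equivalently, if and only if $g_{\mathrm{odd}}\neq0$, where $g_{\mathrm{odd}}$ is the sum of the odd-degree terms of $g$.
   Context: The Lie algebra $\mathfrak{sl}(2)$ over $\mathbb C$ has basis $e,f,h$ with $[h,e]=e$, $[h,f]=-f$, $[e,f]=2h$. $T_3(g)$ denotes the space $\mathbb C[t]e^g$ (with $\partial=d/dt$ acting by $\partial(pe^g)=(p'+pg')e^g$) regarded as an $\mathfrak{sl}(2)$-module via $e\mapsto\tfrac12t^2$, $f\mapsto-\tfrac12\partial^2$, $h\mapsto\tfrac12t\partial+\tfrac14$. A polynomial is even if only even powers of $t$ occur in it (so $0$ is even). *)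

theory Defs
  imports
    "HOL-Analysis.Analysis"
    "HOL-Library.Function_Algebras"
    "HOL-Computational_Algebra.Polynomial"
begin

section \<open>Lie algebras and their modules\<close>

text \<open>Lie algebras and modules live on subspaces \<open>L\<close>, \<open>V\<close> of ambient vector spaces.\<close>

locale lie_algebra = vector_space scaleL
  for scaleL :: "'k::field \<Rightarrow> 'l::ab_group_add \<Rightarrow> 'l" +
  fixes L :: "'l set" and br :: "'l \<Rightarrow> 'l \<Rightarrow> 'l"
  assumes subspace_L: "subspace L"
    and br_closed: "x \<in> L \<Longrightarrow> y \<in> L \<Longrightarrow> br x y \<in> L"
    and br_add_left: "x \<in> L \<Longrightarrow> y \<in> L \<Longrightarrow> z \<in> L \<Longrightarrow> br (x + y) z = br x z + br y z"
    and br_add_right: "x \<in> L \<Longrightarrow> y \<in> L \<Longrightarrow> z \<in> L \<Longrightarrow> br x (y + z) = br x y + br x z"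
    and br_scale_left: "x \<in> L \<Longrightarrow> y \<in> L \<Longrightarrow> br (scaleL c x) y = scaleL c (br x y)"
    and br_scale_right: "x \<in> L \<Longrightarrow> y \<in> L \<Longrightarrow> br x (scaleL c y) = scaleL c (br x y)"
    and br_alternating: "x \<in> L \<Longrightarrow> br x x = 0"
    and br_jacobi: "x \<in> L \<Longrightarrow> y \<in> L \<Longrightarrow> z \<in> L \<Longrightarrow>
          br x (br y z) + br y (br z x) + br z (br x y) = 0"

locale lie_module = lie_algebra scaleL L br + V: vector_space scaleV
  for scaleL :: "'k::field \<Rightarrow> 'l::ab_group_add \<Rightarrow> 'l" and L br
    and scaleV :: "'k \<Rightarrow> 'v::ab_group_add \<Rightarrow> 'v" +
  fixes V :: "'v set" and act :: "'l \<Rightarrow> 'v \<Rightarrow> 'v"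
  assumes subspace_V: "V.subspace V"
    and act_closed: "x \<in> L \<Longrightarrow> v \<in> V \<Longrightarrow> act x v \<in> V"
    and act_add_left: "x \<in> L \<Longrightarrow> y \<in> L \<Longrightarrow> v \<in> V \<Longrightarrow> act (x + y) v = act x v + act y v"
    and act_scale_left: "x \<in> L \<Longrightarrow> v \<in> V \<Longrightarrow> act (scaleL c x) v = scaleV c (act x v)"
    and act_add_right: "x \<in> L \<Longrightarrow> v \<in> V \<Longrightarrow> w \<in> V \<Longrightarrow> act x (v + w) = act x v + act x w"
    and act_scale_right: "x \<in> L \<Longrightarrow> v \<in> V \<Longrightarrow> act x (scaleV c v) = scaleV c (act x v)"
    and act_br: "x \<in> L \<Longrightarrow> y \<in> L \<Longrightarrow> v \<in> V \<Longrightarrow>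
          act (br x y) v = act x (act y v) - act y (act x v)"
begin

definition submodule :: "'v set \<Rightarrow> bool" where
  "submodule W \<longleftrightarrow> V.subspace W \<and> W \<subseteq> V \<and> (\<forall>x\<in>L. \<forall>w\<in>W. act x w \<in> W)"

end

definition simple_lie_module ::
  "('k::field \<Rightarrow> 'l::ab_group_add \<Rightarrow> 'l) \<Rightarrow> 'l set \<Rightarrow> ('l \<Rightarrow> 'l \<Rightarrow> 'l) \<Rightarrow>
   ('k \<Rightarrow> 'v::ab_group_add \<Rightarrow> 'v) \<Rightarrow> 'v set \<Rightarrow> ('l \<Rightarrow> 'v \<Rightarrow> 'v) \<Rightarrow> bool" where
  "simple_lie_module scaleL L br scaleV V act \<longleftrightarrow>
     lie_module scaleL L br scaleV V act \<and> V \<noteq> {0} \<and>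
     (\<forall>W. lie_module.submodule L scaleV V act W \<longrightarrow> W = {0} \<or> W = V)"


section \<open>The Lie algebra \<open>sl(2)\<close> over the complex numbers\<close>

definition mat_scale :: "complex \<Rightarrow> complex^2^2 \<Rightarrow> complex^2^2" where
  "mat_scale c A = (\<chi> i j. c * A $ i $ j)"

definition sl2 :: "(complex^2^2) set" where
  "sl2 = {A. trace A = 0}"

definition commutator :: "complex^2^2 \<Rightarrow> complex^2^2 \<Rightarrow> complex^2^2" where
  "commutator A B = A ** B - B ** A"

text \<open>The Cartan element is normalised as half the usual one.\<close>

definition sl2_e :: "complex^2^2" where "sl2_e = vector [vector [0, 1], vector [0, 0]]"
definition sl2_f :: "complex^2^2" where "sl2_f = vector [vector [0, 0], vector [1, 0]]"
definition sl2_h :: "complex^2^2" where "sl2_h = vector [vector [1/2, 0], vector [0, -1/2]]"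

lemmas mat2_simps = vec_eq_iff forall_2 sum_2 trace_def matrix_matrix_mult_def mat_scale_def
  sl2_def commutator_def sl2_e_def sl2_f_def sl2_h_def

lemma sl2_relations:
  "commutator sl2_h sl2_e = sl2_e"
  "commutator sl2_h sl2_f = - sl2_f"
  "commutator sl2_e sl2_f = mat_scale 2 sl2_h"
  by (simp_all add: mat2_simps)

lemma sl2_basis_mem: "sl2_e \<in> sl2" "sl2_f \<in> sl2" "sl2_h \<in> sl2"
  by (simp_all add: mat2_simps)

lemma sl2_basis_expansion:
  assumes "A \<in> sl2"
  shows "A = mat_scale a sl2_e + mat_scale b sl2_f + mat_scale c sl2_h \<longleftrightarrow>
         a = A $ 1 $ 2 \<and> b = A $ 2 $ 1 \<and> c = 2 * A $ 1 $ 1"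
proof -
  have "A $ 2 $ 2 = - A $ 1 $ 1"
    using assms by (simp add: mat2_simps add_eq_0_iff)
  then show ?thesis
    by (auto simp: mat2_simps)
qed

lemma vector_space_mat_scale: "vector_space mat_scale"
  by unfold_locales (simp_all add: mat_scale_def vec_eq_iff algebra_simps)

lemma lie_algebra_sl2: "lie_algebra mat_scale sl2 commutator"
proof -
  interpret vector_space mat_scale by (rule vector_space_mat_scale)
  show ?thesis
  proof
    show "subspace sl2"
      by (rule subspaceI) (auto simp: mat2_simps add_eq_0_iff2)
  qed (auto simp: mat2_simps algebra_simps)
qed


section \<open>The module \<open>T\<^sub>3(g)\<close>\<close>

text \<open>
  The space \<open>\<complex>[t]e\<^sup>g\<close> is realised as the space of functions
  \<open>t \<mapsto> p(t) exp (g(t))\<close> on the complex plane, with \<open>\<partial>\<close> the complex derivative;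
  \<open>deriv_poly_exp\<close> below is the formula for \<open>\<partial>(p e\<^sup>g)\<close>.
\<close>

definition fun_scale :: "complex \<Rightarrow> (complex \<Rightarrow> complex) \<Rightarrow> complex \<Rightarrow> complex" where
  "fun_scale c F = (\<lambda>t. c * F t)"

definition poly_exp :: "complex poly \<Rightarrow> complex poly \<Rightarrow> complex \<Rightarrow> complex" where
  "poly_exp g p = (\<lambda>t. poly p t * exp (poly g t))"

definition T3_space :: "complex poly \<Rightarrow> (complex \<Rightarrow> complex) set" where
  "T3_space g = range (poly_exp g)"

definition T3_e :: "(complex \<Rightarrow> complex) \<Rightarrow> complex \<Rightarrow> complex" where
  "T3_e F = (\<lambda>t. 1/2 * t^2 * F t)"

definition T3_f :: "(complex \<Rightarrow> complex) \<Rightarrow> complex \<Rightarrow> complex" where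
  "T3_f F = (\<lambda>t. - 1/2 * deriv (deriv F) t)"

definition T3_h :: "(complex \<Rightarrow> complex) \<Rightarrow> complex \<Rightarrow> complex" where
  "T3_h F = (\<lambda>t. 1/2 * t * deriv F t + 1/4 * F t)"

text \<open>Linear extension to \<open>sl(2)\<close>; the coordinates are those of \<open>sl2_basis_expansion\<close>.\<close>

definition T3_act :: "complex^2^2 \<Rightarrow> (complex \<Rightarrow> complex) \<Rightarrow> complex \<Rightarrow> complex" where
  "T3_act A F = fun_scale (A $ 1 $ 2) (T3_e F) + fun_scale (A $ 2 $ 1) (T3_f F)
              + fun_scale (2 * A $ 1 $ 1) (T3_h F)"

lemma T3_act_basis:
  "T3_act sl2_e = T3_e" "T3_act sl2_f = T3_f" "T3_act sl2_h = T3_h"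
  by (simp_all add: T3_act_def fun_scale_def fun_eq_iff sl2_e_def sl2_f_def sl2_h_def)

lemma deriv_poly_exp: "deriv (poly_exp g p) = poly_exp g (pderiv p + p * pderiv g)"
proof
  fix t
  have "((\<lambda>t. poly p t * exp (poly g t)) has_field_derivative
          poly (pderiv p + p * pderiv g) t * exp (poly g t)) (at t)"
    by (auto intro!: derivative_eq_intros poly_DERIV simp: algebra_simps)
  then show "deriv (poly_exp g p) t = poly_exp g (pderiv p + p * pderiv g) t"
    unfolding poly_exp_def by (rule DERIV_imp_deriv)
qed

lemma vector_space_fun_scale: "vector_space fun_scale"
  by unfold_locales (simp_all add: fun_scale_def fun_eq_iff algebra_simps)

lemma poly_exp_linear:
  "poly_exp g (p + q) = poly_exp g p + poly_exp g q"
  "poly_exp g (p - q) = poly_exp g p - poly_exp g q"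
  "poly_exp g (smult c p) = fun_scale c (poly_exp g p)"
  by (simp_all add: poly_exp_def fun_scale_def fun_eq_iff algebra_simps)

context
  fixes g :: "complex poly"
begin

private definition D :: "complex poly \<Rightarrow> complex poly" where
  "D p = pderiv p + p * pderiv g"

private definition actp :: "complex^2^2 \<Rightarrow> complex poly \<Rightarrow> complex poly" where
  "actp A p = smult (A $ 1 $ 2 / 2) (pCons 0 (pCons 0 p)) + smult (- (A $ 2 $ 1) / 2) (D (D p))
     + smult (A $ 1 $ 1) (pCons 0 (D p)) + smult (A $ 1 $ 1 / 2) p"

private lemma D_simps:
  "D (p + q) = D p + D q" "D (p - q) = D p - D q"
  "D (smult c p) = smult c (D p)" "D (pCons 0 p) = p + pCons 0 (D p)"
  by (simp_all add: D_def pderiv_add pderiv_diff pderiv_smult pderiv_pCons algebra_simps smult_add_right)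

private lemma T3_act_poly_exp: "T3_act A (poly_exp g p) = poly_exp g (actp A p)"
  by (simp add: T3_act_def T3_e_def T3_f_def T3_h_def deriv_poly_exp flip: D_def)
     (simp add: poly_exp_def fun_scale_def actp_def fun_eq_iff field_simps power2_eq_square)

lemma lie_module_T3: "lie_module mat_scale sl2 commutator fun_scale (T3_space g) T3_act"
proof -
  interpret lie_algebra mat_scale sl2 commutator by (rule lie_algebra_sl2)
  interpret V: vector_space fun_scale by (rule vector_space_fun_scale)
  have actp_right: "actp A (p + q) = actp A p + actp A q"
      "actp A (smult c p) = smult c (actp A p)" for A p q c
    by (simp_all add: actp_def D_simps smult_add_right smult_diff_right algebra_simps)
  have actp_left: "actp (A + B) p = actp A p + actp B p"
      "actp (mat_scale c A) p = smult c (actp A p)" for A B p c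
    unfolding poly_eq_poly_eq_iff [symmetric] fun_eq_iff
    by (simp_all add: actp_def mat_scale_def field_simps)
  have actp_br: "actp (commutator A B) p = actp A (actp B p) - actp B (actp A p)"
    if "A \<in> sl2" "B \<in> sl2" for A B p
  proof -
    have d: "A $ 2 $ 2 = - A $ 1 $ 1" "B $ 2 $ 2 = - B $ 1 $ 1"
      using that by (simp_all add: mat2_simps add_eq_0_iff)
    have D2: "D (q * 2) = D q + D q" for q
      by (simp only: mult_2_right D_simps)
    show ?thesis
      unfolding poly_eq_poly_eq_iff [symmetric] fun_eq_iff
      by (simp add: actp_def D_simps D2 d commutator_def matrix_matrix_mult_def sum_2 field_simps)
  qed
  show ?thesis
  proof
    show "V.subspace (T3_space g)"
    proof (rule V.subspaceI)
      have "0 = poly_exp g 0" by (simp add: poly_exp_def fun_eq_iff)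
      then show "0 \<in> T3_space g" unfolding T3_space_def by blast
    qed (auto simp: T3_space_def simp flip: poly_exp_linear)
  qed (auto simp: T3_space_def T3_act_poly_exp actp_right actp_left actp_br
         simp flip: poly_exp_linear)
qed

end


section \<open>Even polynomials and odd parts\<close>

definition even_poly :: "complex poly \<Rightarrow> bool" where
  "even_poly p \<longleftrightarrow> (\<forall>i. coeff p i \<noteq> 0 \<longrightarrow> even i)"

definition odd_part :: "complex poly \<Rightarrow> complex poly" where
  "odd_part p = (\<Sum>i | i \<le> degree p \<and> odd i. monom (coeff p i) i)"

end

theory Submission
  imports Defs
begin

text \<open>
  Identify \<open>T\<^sub>3(g)\<close> with \<open>\<complex>[t]\<close>, where \<open>\<partial>\<close> becomes \<open>D = d/dt + g'\<close>; submodules are the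
  subspaces stable under \<open>t\<^sup>2\<close>, \<open>tD\<close>, \<open>D\<^sup>2\<close>, the even part of the Weyl algebra.
  If \<open>g\<close> is even, the even polynomials form a proper submodule. Conversely, let \<open>W \<noteq> 0\<close> be
  a submodule and put \<open>X = tW + DW\<close>. Then \<open>t\<close> and \<open>D\<close> exchange \<open>W\<close> and \<open>X\<close>, so \<open>W \<inter> X\<close> and
  \<open>W + X\<close> are stable under the whole Weyl algebra, for which \<open>\<complex>[t]\<close> is simple. Hence either
  \<open>W = \<complex>[t]\<close>, or \<open>\<complex>[t] = W \<oplus> X\<close>. In the latter case write \<open>1 = w + x\<close>; the reflection
  that is \<open>1\<close> on \<open>W\<close> and \<open>-1\<close> on \<open>X\<close> is \<open>p(t) \<mapsto> p(-t) s(t)\<close> with \<open>s = w - x\<close>, so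
  \<open>s(-t) s(t) = 1\<close> and \<open>s\<close> is constant. Thus \<open>1\<close> lies in \<open>W\<close> or in \<open>X\<close>, the grading
  is the one by parity up to a swap, and \<open>g' = D 1\<close> is odd.
\<close>

section \<open>Reflection of polynomials\<close>

definition poly_reflect :: "'a::comm_ring_1 poly \<Rightarrow> 'a poly" where
  "poly_reflect p = pcompose p [:0, -1:]"

lemma poly_reflect_simps [simp]:
  "poly_reflect 0 = 0" "poly_reflect 1 = 1"
  "poly_reflect (pCons a p) = [:a:] - pCons 0 (poly_reflect p)"
  "poly_reflect (p + q) = poly_reflect p + poly_reflect q"
  "poly_reflect (p - q) = poly_reflect p - poly_reflect q"
  "poly_reflect (- p) = - poly_reflect p"
  "poly_reflect (p * q) = poly_reflect p * poly_reflect q"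
  "poly_reflect (smult c p) = smult c (poly_reflect p)"
  by (simp_all add: poly_reflect_def pcompose_pCons pcompose_add pcompose_diff pcompose_uminus
      pcompose_mult pcompose_smult pcompose_1)

lemma coeff_poly_reflect: "coeff (poly_reflect p) n = (-1) ^ n * coeff p n"
  by (simp add: poly_reflect_def coeff_pcompose_linear)

lemma pderiv_poly_reflect: "pderiv (poly_reflect p) = - poly_reflect (pderiv p)"
  for p :: "'a::idom poly"
  by (simp add: poly_reflect_def pderiv_pcompose pderiv_pCons)

lemma even_poly_iff_reflect: "even_poly p \<longleftrightarrow> poly_reflect p = p"
  by (auto simp: even_poly_def poly_eq_iff coeff_poly_reflect minus_one_power_iff)

text \<open>The factor \<open>Suc n\<close> in the coefficients of \<open>pderiv g\<close> is
  nonzero in characteristic 0, so only the constant term of \<open>g\<close> is lost, and its degree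
  is even.\<close>

lemma pderiv_reflect_eq_imp_even_poly:
  assumes "poly_reflect (pderiv g) = - pderiv g"
  shows "even_poly g"
  unfolding even_poly_def
proof (intro allI impI)
  fix i assume i: "coeff g i \<noteq> 0"
  show "even i"
  proof (cases i)
    case (Suc n)
    have "(-1) ^ n * coeff (pderiv g) n = - coeff (pderiv g) n"
      using assms by (metis coeff_poly_reflect coeff_minus)
    moreover have "coeff (pderiv g) n \<noteq> 0"
      using i Suc by (simp add: coeff_pderiv del: of_nat_Suc)
    ultimately show ?thesis
      using Suc by (auto simp: minus_one_power_iff split: if_splits)
  qed simp
qed

lemma coeff_odd_part: "coeff (odd_part p) n = (if odd n then coeff p n else 0)"
proof -
  have "coeff (odd_part p) n = (\<Sum>i | i \<le> degree p \<and> odd i. if i = n then coeff p i else 0)"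
    by (simp add: odd_part_def coeff_sum)
  also have "\<dots> = (if n \<le> degree p \<and> odd n then coeff p n else 0)"
    by (simp add: sum.delta')
  finally show ?thesis by (auto simp: coeff_eq_0)
qed

lemma odd_part_eq_0_iff: "odd_part p = 0 \<longleftrightarrow> even_poly p"
  by (auto simp: poly_eq_iff coeff_odd_part even_poly_def)


section \<open>Gradings of the polynomial ring\<close>

global_interpretation poly: vector_space "smult :: 'a::field \<Rightarrow> 'a poly \<Rightarrow> 'a poly"
  by unfold_locales (simp_all add: smult_add_right smult_add_left)

text \<open>Stability under t makes \<open>U\<close> an ideal, so the twist \<open>p * q\<close> can
  be subtracted and \<open>U\<close> is stable under \<open>pderiv\<close> itself. Differentiation
  then lowers the degree of \<open>u\<close> down to a nonzero constant, since in characteristic 0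
  only constants have derivative 0.\<close>

lemma subspace_closed_mult_pderiv_eq_UNIV:
  fixes U :: "'a::field_char_0 poly set"
  assumes U: "poly.subspace U" "u \<in> U" "u \<noteq> 0"
    and mult: "\<And>p. p \<in> U \<Longrightarrow> pCons 0 p \<in> U"
    and D: "\<And>p. p \<in> U \<Longrightarrow> pderiv p + p * q \<in> U"
  shows "U = UNIV"
proof -
  have mult': "r * p \<in> U" if "p \<in> U" for r p
  proof (induction r)
    case 0
    then show ?case using U by (simp add: poly.subspace_0)
  next
    case (pCons a r)
    then show ?case using that U mult
      by (simp add: poly.subspace_add poly.subspace_scale)
  qed
  have pderiv: "pderiv p \<in> U" if "p \<in> U" for p
    using poly.subspace_diff [OF U(1) D [OF that] mult' [OF that, of q]]
    by (simp add: mult.commute)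
  have "1 \<in> U" using U(2,3)
  proof (induction "degree u" arbitrary: u rule: less_induct)
    case less
    show ?case
    proof (cases "degree u = 0")
      case True
      then obtain c where c: "u = [:c:]" by (rule degree_eq_zeroE)
      with less.prems have "c \<noteq> 0" by auto
      with c have "1 = smult (1 / c) u" by (simp add: one_pCons)
      with less.prems U(1) show ?thesis by (metis poly.subspace_scale)
    next
      case False
      then have "degree (pderiv u) < degree u" "pderiv u \<noteq> 0"
        by (simp_all add: degree_pderiv pderiv_eq_0_iff)
      with less pderiv show ?thesis by blast
    qed
  qed
  then show ?thesis using mult' [of 1] by auto
qed

section \<open>Two subspaces exchanged by multiplication by t\<close>

text \<open>The factors of \<open>u\<close> are twice the even and twice the odd part of
  \<open>p\<close>. Each t swaps \<open>W\<close> and \<open>X\<close>, so even powers keep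
  \<open>u\<close> in \<open>W\<close> and odd powers move it to \<open>X\<close>; in the induction
  each claim yields the other.\<close>

lemma reflect_parts_mem:
  assumes W: "poly.subspace W" and X: "poly.subspace X"
    and tW: "\<And>p. p \<in> W \<Longrightarrow> pCons 0 p \<in> X" and tX: "\<And>p. p \<in> X \<Longrightarrow> pCons 0 p \<in> W"
    and u: "u \<in> W"
  shows "p * u + poly_reflect p * u \<in> W \<and> p * u - poly_reflect p * u \<in> X"
proof (induction p)
  case 0
  then show ?case using W X by (simp add: poly.subspace_0)
next
  case (pCons a p)
  have "pCons a p * u + poly_reflect (pCons a p) * u
      = smult a u + smult a u + pCons 0 (p * u - poly_reflect p * u)"
    by (simp add: algebra_simps)
  moreover have "pCons a p * u - poly_reflect (pCons a p) * u
      = pCons 0 (p * u + poly_reflect p * u)"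
    by (simp add: algebra_simps)
  ultimately show ?case
    using pCons.IH tW tX W u by (metis poly.subspace_add poly.subspace_scale)
qed

text \<open>Directness forces \<open>p \<mapsto> poly_reflect p * s\<close> to fix \<open>w\<close>
  and to negate \<open>x\<close>. Adding the two equations gives s(-t) s(t) = 1, which leaves only
  constants for \<open>s\<close>.\<close>

lemma graded_one_mem:
  fixes W X :: "'a::field_char_0 poly set"
  assumes W: "poly.subspace W" and X: "poly.subspace X"
    and tW: "\<And>p. p \<in> W \<Longrightarrow> pCons 0 p \<in> X" and tX: "\<And>p. p \<in> X \<Longrightarrow> pCons 0 p \<in> W"
    and disj: "W \<inter> X = {0}" and w: "w \<in> W" and x: "x \<in> X" and one: "w + x = 1"
  shows "1 \<in> W \<or> 1 \<in> X"
proof -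
  define s where "s = w - x"
  have p: "p = p * w + p * x" for p
    using one by (metis distrib_left mult.right_neutral)
  note partsw = reflect_parts_mem [OF W X tW tX w]
  note partsx = reflect_parts_mem [OF X W tX tW x]
  \<comment> \<open>This and \<open>diff\<close> produce twice the components of \<open>p\<close> in
    \<open>W\<close> and in \<open>X\<close>.\<close>
  have sum: "p + poly_reflect p * s \<in> W" for p
  proof -
    have "p + poly_reflect p * s
        = (p * w + poly_reflect p * w) + (p * x - poly_reflect p * x)"
      by (subst (1) p) (simp add: s_def algebra_simps)
    then show ?thesis using partsw partsx W by (metis poly.subspace_add)
  qed
  have diff: "p - poly_reflect p * s \<in> X" for p
  proof -
    have "p - poly_reflect p * s
        = (p * w - poly_reflect p * w) + (p * x + poly_reflect p * x)"
      by (subst (1) p) (simp add: s_def algebra_simps)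
    then show ?thesis using partsw partsx X by (metis poly.subspace_add)
  qed
  \<comment> \<open>By \<open>diff\<close> the same element lies in \<open>X\<close>, hence it
    vanishes.\<close>
  have "w - poly_reflect w * s \<in> W"
  proof -
    have "w - poly_reflect w * s = smult 2 w - (w + poly_reflect w * s)"
      unfolding poly_eq_poly_eq_iff [symmetric] fun_eq_iff by simp
    then show ?thesis using W w sum by (metis poly.subspace_diff poly.subspace_scale)
  qed
  with diff [of w] disj have "w - poly_reflect w * s = 0" by blast
  then have sw: "w = poly_reflect w * s" by simp
  have "x + poly_reflect x * s \<in> X"
  proof -
    have "x + poly_reflect x * s = smult 2 x - (x - poly_reflect x * s)"
      unfolding poly_eq_poly_eq_iff [symmetric] fun_eq_iff by simp
    then show ?thesis using X x diff by (metis poly.subspace_diff poly.subspace_scale)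
  qed
  with sum [of x] disj have "x + poly_reflect x * s = 0" by blast
  then have sx: "x = - poly_reflect x * s" by (simp add: eq_neg_iff_add_eq_0)
  have "w + x = poly_reflect w * s + - poly_reflect x * s"
    using sw sx by (rule arg_cong2)
  also have "\<dots> = poly_reflect s * s"
    by (simp add: s_def algebra_simps)
  finally have "1 = poly_reflect s * s" using one by simp
  then have "degree s = 0"
    by (metis dvd_triv_right is_unit_iff_degree mult_zero_right zero_neq_one)
  then obtain c where c: "s = [:c:]" by (rule degree_eq_zeroE)
  have "smult 2 w = (w + x) + (w - x)"
    unfolding poly_eq_poly_eq_iff [symmetric] fun_eq_iff by simp
  then have w2: "smult 2 w = [:1 + c:]"
    using one c by (simp add: s_def one_pCons)
  \<comment> \<open>Now \<open>w\<close> is the constant (1 + c)/2: either it is 0 and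
    \<open>x\<close> is 1, or rescaling it gives 1.\<close>
  show ?thesis
  proof (cases "1 + c = 0")
    case True
    then have "w = 0" using w2 by simp
    with one x show ?thesis by simp
  next
    case False
    then have "1 = smult (1 / (1 + c)) (smult 2 w)" by (simp only: w2) (simp add: one_pCons)
    with w W show ?thesis by (metis poly.subspace_scale)
  qed
qed

text \<open>With 1 in \<open>W\<close>, the even part of \<open>p\<close> lies in \<open>W\<close>
  and the odd part in \<open>X\<close>. As \<open>p\<close> is in \<open>X\<close>, its even part
  lies in both, so it is 0.\<close>

lemma graded_reflect_eq:
  fixes W X :: "'a::field_char_0 poly set"
  assumes W: "poly.subspace W" and X: "poly.subspace X"
    and tW: "\<And>p. p \<in> W \<Longrightarrow> pCons 0 p \<in> X" and tX: "\<And>p. p \<in> X \<Longrightarrow> pCons 0 p \<in> W"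
    and disj: "W \<inter> X = {0}" and one: "1 \<in> W" and p: "p \<in> X"
  shows "poly_reflect p = - p"
proof -
  note parts = reflect_parts_mem [OF W X tW tX one, of p]
  have "p + poly_reflect p = smult 2 p - (p - poly_reflect p)"
    unfolding poly_eq_poly_eq_iff [symmetric] fun_eq_iff by simp
  with parts p X have "p + poly_reflect p \<in> X"
    by (metis mult.right_neutral poly.subspace_diff poly.subspace_scale)
  with parts disj have "p + poly_reflect p = 0" by auto
  then show ?thesis by (simp add: eq_neg_iff_add_eq_0 add.commute)
qed

section \<open>Subspaces stable under the even part of the Weyl algebra\<close>

lemma even_weyl_subspace_eq_UNIV:
  fixes W :: "complex poly set" and g :: "complex poly"
  defines "D \<equiv> \<lambda>p. pderiv p + p * pderiv g"
  assumes g: "\<not> even_poly g"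
    and W: "poly.subspace W" and W0: "u \<in> W" "u \<noteq> 0"
    and tt: "\<And>p. p \<in> W \<Longrightarrow> pCons 0 (pCons 0 p) \<in> W"
    and tD: "\<And>p. p \<in> W \<Longrightarrow> pCons 0 (D p) \<in> W"
    and DD: "\<And>p. p \<in> W \<Longrightarrow> D (D p) \<in> W"
  shows "W = UNIV"
proof (rule ccontr)
  assume neq: "W \<noteq> UNIV"
  have D_simps: "D (p + q) = D p + D q" "D (smult c p) = smult c (D p)"
      "D (pCons 0 p) = p + pCons 0 (D p)" "D 0 = 0" for p q c
    by (simp_all add: D_def pderiv_add pderiv_smult pderiv_pCons algebra_simps smult_add_right)
  define X where "X = {pCons 0 a + D b |a b. a \<in> W \<and> b \<in> W}"
  have X: "poly.subspace X"
  proof (rule poly.subspaceI)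
    show "0 \<in> X" using poly.subspace_0 [OF W] D_simps(4) unfolding X_def by force
  next
    fix p q assume "p \<in> X" "q \<in> X"
    then obtain a b c d where "a \<in> W" "b \<in> W" "c \<in> W" "d \<in> W"
      and "p = pCons 0 a + D b" "q = pCons 0 c + D d" unfolding X_def by blast
    moreover from this have "p + q = pCons 0 (a + c) + D (b + d)"
      by (simp add: D_simps algebra_simps)
    ultimately show "p + q \<in> X" unfolding X_def using W poly.subspace_add by blast
  next
    fix c p assume "p \<in> X"
    then obtain a b where "a \<in> W" "b \<in> W" and "p = pCons 0 a + D b" unfolding X_def by blast
    moreover from this have "smult c p = pCons 0 (smult c a) + D (smult c b)"
      by (simp add: D_simps smult_add_right)
    ultimately show "smult c p \<in> X" unfolding X_def using W poly.subspace_scale by blast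
  qed
  have tW: "pCons 0 p \<in> X" if "p \<in> W" for p
    using that poly.subspace_0 [OF W] D_simps(4) unfolding X_def by force
  have DW: "D p \<in> X" if "p \<in> W" for p
    using that poly.subspace_0 [OF W] unfolding X_def by force
  have tX: "pCons 0 p \<in> W" if pX: "p \<in> X" for p
  proof -
    obtain a b where ab: "a \<in> W" "b \<in> W" "p = pCons 0 a + D b" using pX unfolding X_def by blast
    then have "pCons 0 p = pCons 0 (pCons 0 a) + pCons 0 (D b)" by simp
    then show ?thesis using ab tt tD W by (metis poly.subspace_add)
  qed
  have DX: "D p \<in> W" if pX: "p \<in> X" for p
  proof -
    obtain a b where ab: "a \<in> W" "b \<in> W" "p = pCons 0 a + D b" using pX unfolding X_def by blast
    \<comment> \<open>The commutation rule D t = 1 + t D rewrites the first summand by even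
      operators.\<close>
    then have "D p = (a + pCons 0 (D a)) + D (D b)" by (simp add: D_simps)
    then show ?thesis using ab DD tD W by (metis poly.subspace_add)
  qed
  \<comment> \<open>A nonzero intersection would be a nonzero Weyl submodule, hence everything,
    against \<open>neq\<close>.\<close>
  have disj: "W \<inter> X = {0}"
  proof (rule ccontr)
    assume "W \<inter> X \<noteq> {0}"
    then obtain v where "v \<in> W \<inter> X" "v \<noteq> 0"
      using poly.subspace_0 [OF W] poly.subspace_0 [OF X] by blast
    moreover have "poly.subspace (W \<inter> X)" by (rule poly.subspace_inter [OF W X])
    ultimately have "W \<inter> X = UNIV"
      by (rule_tac subspace_closed_mult_pderiv_eq_UNIV [where q = "pderiv g"])
        (use tW tX DW DX in \<open>auto simp: D_def\<close>)
    with neq show False by blast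
  qed
  let ?S = "{a + b |a b. a \<in> W \<and> b \<in> X}"
  have "?S = UNIV"
  proof (rule subspace_closed_mult_pderiv_eq_UNIV [where q = "pderiv g"])
    show "poly.subspace ?S" by (rule poly.subspace_sums [OF W X])
    show "u \<in> ?S" using W0 poly.subspace_0 [OF X] by force
    show "u \<noteq> 0" by fact
    fix p assume "p \<in> ?S"
    then obtain a b where ab: "a \<in> W" "b \<in> X" "p = a + b" by blast
    then have "pCons 0 p = pCons 0 b + pCons 0 a" "D p = D b + D a" by (simp_all add: D_simps)
    moreover have "pCons 0 b \<in> W" "pCons 0 a \<in> X" "D b \<in> W" "D a \<in> X"
      using ab tW tX DW DX by blast+
    ultimately have "pCons 0 p \<in> ?S" "D p \<in> ?S" by (metis (mono_tags, lifting) mem_Collect_eq)+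
    then show "pCons 0 p \<in> ?S" "pderiv p + p * pderiv g \<in> ?S" by (simp_all only: D_def)
  qed
  then have "1 \<in> ?S" by simp
  then obtain w x where "w \<in> W" "x \<in> X" "w + x = 1" by auto
  then have "1 \<in> W \<or> 1 \<in> X" using graded_one_mem [OF W X tW tX disj] by blast
  \<comment> \<open>D 1 = g' lies in the summand opposite to the one containing 1; the second case
    exchanges the roles of \<open>W\<close> and \<open>X\<close>.\<close>
  then have "poly_reflect (pderiv g) = - pderiv g"
  proof
    assume one: "1 \<in> W"
    then have "pderiv g \<in> X" using DW [OF one] by (simp add: D_def)
    then show ?thesis using graded_reflect_eq [OF W X tW tX disj one] by blast
  next
    assume one: "1 \<in> X"
    then have "pderiv g \<in> W" using DX [OF one] by (simp add: D_def)
    then show ?thesis using graded_reflect_eq [OF X W tX tW _ one] disj by blast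
  qed
  with g show False using pderiv_reflect_eq_imp_even_poly by blast
qed


section \<open>Submodules of \<open>T\<^sub>3(g)\<close>\<close>

text \<open>The exponential never vanishes and can be cancelled.\<close>

lemma poly_exp_eq_iff: "poly_exp g p = poly_exp g q \<longleftrightarrow> p = q"
  by (auto simp: poly_exp_def fun_eq_iff simp flip: poly_eq_poly_eq_iff)

lemma poly_exp_0: "poly_exp g 0 = 0"
  by (simp add: poly_exp_def fun_eq_iff)

lemma T3_poly_exp:
  "T3_e (poly_exp g p) = poly_exp g (smult (1/2) (pCons 0 (pCons 0 p)))"
  "T3_f (poly_exp g p) = poly_exp g (smult (-1/2)
     (pderiv (pderiv p + p * pderiv g) + (pderiv p + p * pderiv g) * pderiv g))"
  "T3_h (poly_exp g p) = poly_exp g (smult (1/2) (pCons 0 (pderiv p + p * pderiv g)) + smult (1/4) p)"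
  by (simp_all add: T3_e_def T3_f_def T3_h_def deriv_poly_exp)
    (simp_all add: poly_exp_def fun_eq_iff power2_eq_square algebra_simps)

text \<open>Pulling \<open>W\<close> back along \<open>poly_exp g\<close> reduces the claim to
  polynomials, where e, f and h act by t^2, D^2 and t D up to nonzero scalars and a shift.\<close>

lemma submodule_T3_trivial:
  assumes g: "\<not> even_poly g" and sub: "lie_module.submodule sl2 fun_scale (T3_space g) T3_act W"
  shows "W = {0} \<or> W = T3_space g"
proof -
  interpret lie_module mat_scale sl2 commutator fun_scale "T3_space g" T3_act
    by (rule lie_module_T3)
  have W: "V.subspace W" "W \<subseteq> T3_space g" and act: "\<And>A F. A \<in> sl2 \<Longrightarrow> F \<in> W \<Longrightarrow> T3_act A F \<in> W"
    using sub by (auto simp: submodule_def)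
  show ?thesis
  proof (cases "W \<subseteq> {0}")
    case True
    then show ?thesis using V.subspace_0 [OF W(1)] by blast
  next
    case False
    define P where "P = {p. poly_exp g p \<in> W}"
    have P: "poly.subspace P"
      using W(1) by (auto simp: P_def poly.subspace_def V.subspace_def poly_exp_linear poly_exp_0)
    have scale: "p \<in> P" if "smult c p \<in> P" "c \<noteq> 0" for c p
      using poly.subspace_scale [OF P that(1), of "1 / c"] that(2) by simp
    obtain u where u: "u \<in> P" "u \<noteq> 0"
    proof -
      obtain F where "F \<in> W" "F \<noteq> 0" using False by blast
      moreover from this W(2) obtain p where "F = poly_exp g p" by (auto simp: T3_space_def)
      ultimately show ?thesis using that [of p] poly_exp_0 [of g] by (metis P_def mem_Collect_eq)
    qed
    have T3: "T3_e F \<in> W" "T3_f F \<in> W" "T3_h F \<in> W" if "F \<in> W" for F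
      using act [of sl2_e F] act [of sl2_f F] act [of sl2_h F] that
      by (simp_all add: T3_act_basis sl2_basis_mem)
    have "P = UNIV"
    proof (rule even_weyl_subspace_eq_UNIV [OF g P u])
      fix p assume p: "p \<in> P"
      then have F: "poly_exp g p \<in> W" by (simp add: P_def)
      have "smult (1/2) (pCons 0 (pCons 0 p)) \<in> P"
        using T3(1) [OF F] unfolding T3_poly_exp by (simp only: P_def mem_Collect_eq)
      then show "pCons 0 (pCons 0 p) \<in> P" by (rule scale) simp
      have "smult (-1/2) (pderiv (pderiv p + p * pderiv g) + (pderiv p + p * pderiv g) * pderiv g) \<in> P"
        using T3(2) [OF F] unfolding T3_poly_exp by (simp only: P_def mem_Collect_eq)
      then show "pderiv (pderiv p + p * pderiv g) + (pderiv p + p * pderiv g) * pderiv g \<in> P"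
        by (rule scale) simp
      \<comment> \<open>The shift by 1/4 in h contributes a multiple of \<open>p\<close>, which is
        in \<open>P\<close> and can be subtracted.\<close>
      have "smult (1/2) (pCons 0 (pderiv p + p * pderiv g)) + smult (1/4) p \<in> P"
        using T3(3) [OF F] unfolding T3_poly_exp by (simp only: P_def mem_Collect_eq)
      from poly.subspace_diff [OF P this poly.subspace_scale [OF P p, of "1/4"]]
      have "smult (1/2) (pCons 0 (pderiv p + p * pderiv g)) \<in> P"
        by (simp only: add_diff_cancel_right')
      then show "pCons 0 (pderiv p + p * pderiv g) \<in> P" by (rule scale) simp
    qed
    then show ?thesis using W(2) by (auto simp: P_def T3_space_def)
  qed
qed

text \<open>For even \<open>g\<close> the derivative g' is odd, so D reverses parity, as t does; the
  products t^2, t D and D^2 preserve it.\<close>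

lemma even_submodule_T3:
  assumes g: "even_poly g"
  shows "lie_module.submodule sl2 fun_scale (T3_space g) T3_act (poly_exp g ` {p. even_poly p})"
    (is "lie_module.submodule _ _ _ _ ?W")
proof -
  interpret lie_module mat_scale sl2 commutator fun_scale "T3_space g" T3_act
    by (rule lie_module_T3)
  have W: "V.subspace ?W"
  proof (rule V.subspaceI)
    show "0 \<in> ?W" using poly_exp_0 [of g] by (force simp: even_poly_def)
  qed (auto simp: even_poly_iff_reflect simp flip: poly_exp_linear)
  have g': "poly_reflect (pderiv g) = - pderiv g"
    using g pderiv_poly_reflect [of g] by (simp add: even_poly_iff_reflect equation_minus_iff)
  have pd: "poly_reflect (pderiv p) = - pderiv p" if "even_poly p" for p
    using that pderiv_poly_reflect [of p] by (simp add: even_poly_iff_reflect equation_minus_iff)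
  \<comment> \<open>In D^2 the second differentiation meets an odd polynomial.\<close>
  have pd': "poly_reflect (pderiv p) = pderiv p" if "poly_reflect p = - p" for p :: "complex poly"
    using that pderiv_poly_reflect [of p] by (simp add: pderiv_minus)
  have D: "poly_reflect (pderiv p + p * pderiv g) = - (pderiv p + p * pderiv g)"
    if "even_poly p" for p
    using pd [OF that] that g' by (simp add: even_poly_iff_reflect)
  have "T3_e F \<in> ?W \<and> T3_f F \<in> ?W \<and> T3_h F \<in> ?W" if "F \<in> ?W" for F
  proof -
    obtain p where p: "even_poly p" and F: "F = poly_exp g p" using \<open>F \<in> ?W\<close> by blast
    define q where "q = pderiv p + p * pderiv g"
    have q: "poly_reflect q = - q" using D [OF p] by (simp only: q_def)
    show ?thesis
      unfolding F T3_poly_exp q_def [symmetric]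
      using p q pd' [OF q] g'
      by (intro conjI imageI CollectI) (simp_all add: even_poly_iff_reflect)
  qed
  with W show ?thesis
    unfolding submodule_def T3_act_def
    by (auto simp: T3_space_def intro!: V.subspace_add V.subspace_scale)
qed

theorem theorem6p21:
  fixes g :: "complex poly"
  assumes "coeff g 0 = 0"
  shows "(simple_lie_module mat_scale sl2 commutator fun_scale (T3_space g) T3_act
            \<longleftrightarrow> \<not> even_poly g)
       \<and> (simple_lie_module mat_scale sl2 commutator fun_scale (T3_space g) T3_act
            \<longleftrightarrow> odd_part g \<noteq> 0)"
proof -
  have ne0: "T3_space g \<noteq> {0}"
    by (metis poly_exp_0 poly_exp_eq_iff T3_space_def rangeI singletonD zero_neq_one)
  have "\<not> simple_lie_module mat_scale sl2 commutator fun_scale (T3_space g) T3_act"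
    if g: "even_poly g"
  proof
    \<comment> \<open>This submodule contains \<open>poly_exp g 1\<close> but not
      \<open>poly_exp g [:0, 1:]\<close>, so it is neither zero nor the whole space.\<close>
    let ?W = "poly_exp g ` {p. even_poly p}"
    assume "simple_lie_module mat_scale sl2 commutator fun_scale (T3_space g) T3_act"
    then consider "?W = {0}" | "?W = T3_space g"
      using even_submodule_T3 [OF g] unfolding simple_lie_module_def by blast
    then show False
    proof cases
      case 1
      have "poly_exp g 1 \<in> ?W" by (simp add: even_poly_iff_reflect)
      with 1 have "poly_exp g 1 = poly_exp g 0" by (simp add: poly_exp_0)
      then show ?thesis by (simp add: poly_exp_eq_iff)
    next
      case 2
      then have "poly_exp g [:0, 1:] \<in> ?W" by (auto simp: T3_space_def)
      then have "even_poly [:0, 1:]" by (auto simp: poly_exp_eq_iff)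
      then show ?thesis by (simp add: even_poly_iff_reflect)
    qed
  qed
  moreover have "simple_lie_module mat_scale sl2 commutator fun_scale (T3_space g) T3_act"
    if "\<not> even_poly g"
    using that ne0 lie_module_T3 submodule_T3_trivial unfolding simple_lie_module_def by blast
  ultimately show ?thesis by (auto simp: odd_part_eq_0_iff)
qed

end
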